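(* Suppose that at node $l$ the current optimal solution $x^{*(l)}$ of $(LFP)_l$, given by an optimal simplex tableau, is integer, and that the associated index sets satisfy $\mathcal{H}_l\neq\emptyset$ and $\mathcal{H}'_l\neq\emptyset$. If $x\neq x^{*(l)}$ is an integer efficient solution in the domain $\mathcal{X}_l\setminus\{x^{*(l)}\}$ (that is, $x\in\mathcal{X}_{Eff}\cap(\mathcal{X}_l\setminus\{x^{*(l)}\})$), then $x\in\mathcal{X}_{l+1}=\mathcal{X}^1_{l+1}\cup\mathcal{X}^2_{l+1}$.
   Context: Problem. Let $r\ge 2$, $A\in\mathbb{Z}^{m\times n}$, $b\in\mathbb{Z}^m$, and let $\mathcal{X}=\{x\in\mathbb{R}^n_+ : Ax\le b\}$ be a closed, bounded, non-empty convex polyhedron; put $\mathcal{D}=\mathcal{X}\cap\mathbb{Z}^n$. For $i=1,\dots,r$ let $f_i(x)=\frac12 x^TQ_ix+c_i^Tx$, where $Q_i\in\mathbb{Z}^{n\times n}$ is (symmetric) positive semi-definite and $c_i\in\mathbb{Z}^n$. $(MOIQP)$ is the problem of minimizing $f_1,\dots,f_r$ over $\mathcal{D}$. A point $x^*\in\mathcal{D}$ is efficient for $(MOIQP)$ if there is no $x\in\mathcal{D}$ with $f_i(x)\le f_i(x^* )$ for all $i$ and $f_i(x)<f_i(x^* )$ for at least one $i$; $\mathcal{X}_{\mathcal{Q}}$ denotes the set of efficient points. For $s=1,2$ let $\psi^s(x)=\mathcal{P}^s(x)/\mathcal{Q}^s(x)$ with $\mathcal{P}^s(x)=p^sx+\alpha^s$,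 $\mathcal{Q}^s(x)=q^sx+\beta^s$, where $p^s,q^s$ are real $n$-vectors and $\alpha^s,\beta^s$ are real constants. $(BOILFP)$ is the problem of minimizing $\psi^1,\psi^2$ over $\mathcal{D}$; its efficient set, defined in the same way with $\psi^1,\psi^2$ in place of the $f_i$, is $\mathcal{X}_{\mathcal{F}}$. $\mathcal{X}_{Eff}=\mathcal{X}_{\mathcal{Q}}\cap\mathcal{X}_{\mathcal{F}}$ is the set of solutions efficient for both problems. Standing assumptions: $\mathcal{Q}^s(x)>0$ for all $x\in\mathcal{X}$, $s=1,2$; $\psi^s$ is not a strictly positive combination of the linear parts of the quadratic objectives; $\mathcal{X}_{\mathcal{Q}}\ne\mathcal{D}$. Node $l$. $\mathcal{X}_0=\mathcal{X}$, and $\mathcal{X}_l\subseteq\mathcal{X}$ is the polyhedron at node $l$ of the branch-and-cut tree, obtained from $\mathcal{X}$ by adding finitely many linear constraints with integer coefficients (branching bounds and earlier cuts); it is written in equality form with one non-negative slack/surplus variable per constraint. Variables $x_1,\dots,x_n$ are the original ones, and variables with index larger than $n$ are slack/surplus variables (the values of which are determined by the original variables). $(LFP)_l$ is: minimize $\psi^1(x)$ over $x\in\mathcal{X}_l$. $x^{*(l)}$ is the optimal basic solution of $(LFP)_l$ given by an optimal simplex tableau, with index sets $\mathcal{B}_l$ of basic and $\mathcal{N}_l$ of non-basic variables, so that for points of $\mathcal{X}_l$ one has $x_k=\hat b_{p(k)}-\sum_{j\in\mathcal{N}_l}\hat a_{p(k)j}x_j$ for $k\in\mathcal{B}_l$,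 where $p(k)$ is the tableau row of $x_k$ and $\hat a,\hat b$ are the updated tableau entries. Reduced gradients: for $j\in\mathcal{N}_l$ and $s=1,2$, $\eta^s_j=p^s_j-p^s_{\mathcal{B}_l}\mathcal{B}_l^{-1}a_j$, $\vartheta^s_j=q^s_j-q^s_{\mathcal{B}_l}\mathcal{B}_l^{-1}a_j$ (with $a_j$ the $j$-th column of the constraint matrix of the equality form, $\mathcal{B}_l^{-1}$ the inverse of the basis matrix, and cost coefficients of slack/surplus variables equal to $0$), and $\bar\gamma^s_j=\mathcal{Q}^s(x^{*(l)})\eta^s_j-\mathcal{P}^s(x^{*(l)})\vartheta^s_j$. An optimal tableau satisfies $\bar\gamma^1_j\ge0$ for all $j\in\mathcal{N}_l$. With $\nabla f_i(x^{*(l)})=Q_ix^{*(l)}+c_i$ and $k$-th coordinate $\nabla f_i(x^{*(l)})_k$, let, for $j\in\mathcal{N}_l$, $\bar f_{i,j}=\rho_{i,j}-\sum_{k\in\mathcal{B}_l\cap\{1,\dots,n\}}\nabla f_i(x^{*(l)})_k\,\hat a_{p(k)j}$, where $\rho_{i,j}=\nabla f_i(x^{*(l)})_j$ if $j\le n$ and $\rho_{i,j}=0$ if $j>n$. Index sets: $\mathcal{H}_l=\{j\in\mathcal{N}_l:\exists i\in\{1,\dots,r\},\ \bar f_{i,j}<0\}\cup\{j\in\mathcal{N}_l:\bar f_{i,j}=0\ \forall i\in\{1,\dots,r\}\}$ and $\mathcal{H}'_l=\{j\in\mathcal{N}_l:\bar\gamma^2_j<0\}\cup\{j\in\mathcal{N}_l:\bar\gamma^1_j=0\text{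 and }\bar\gamma^2_j=0\}$. Cut domains: $\mathcal{X}^1_{l+1}=\{x\in\mathcal{X}_l:\sum_{j\in\mathcal{H}_l}x_j\ge1\}$, $\mathcal{X}^2_{l+1}=\{x\in\mathcal{X}_l:\sum_{j\in\mathcal{H}'_l}x_j\ge1\}$, $\mathcal{X}_{l+1}=\mathcal{X}^1_{l+1}\cup\mathcal{X}^2_{l+1}$. *)

theory Defs
  imports "HOL-Analysis.Analysis"
begin

definition real_vec :: "int ^ 'n \<Rightarrow> real ^ 'n" where
  "real_vec v = (\<chi> i. of_int (v $ i))"

definition real_mat :: "int ^ 'n ^ 'm \<Rightarrow> real ^ 'n ^ 'm" where
  "real_mat A = map_matrix of_int A"

definition integer_points :: "(real ^ 'n) set" where
  "integer_points = {x. \<forall>i. x $ i \<in> \<int>}"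

definition efficient_set :: "'i set \<Rightarrow> ('i \<Rightarrow> 'a \<Rightarrow> real) \<Rightarrow> 'a set \<Rightarrow> 'a set" where
  "efficient_set I F D =
     {x \<in> D. \<not> (\<exists>y\<in>D. (\<forall>i\<in>I. F i y \<le> F i x) \<and> (\<exists>i\<in>I. F i y < F i x))}"

definition symmetric_pos_semidef :: "real ^ 'n ^ 'n \<Rightarrow> bool" where
  "symmetric_pos_semidef Q \<longleftrightarrow> transpose Q = Q \<and> (\<forall>x. 0 \<le> x \<bullet> (Q *v x))"

definition quad_obj :: "int ^ 'n ^ 'n \<Rightarrow> int ^ 'n \<Rightarrow> real ^ 'n \<Rightarrow> real" where
  "quad_obj Q c x = 1 / 2 * (x \<bullet> (real_mat Q *v x)) + real_vec c \<bullet> x"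

definition quad_grad :: "int ^ 'n ^ 'n \<Rightarrow> int ^ 'n \<Rightarrow> real ^ 'n \<Rightarrow> real ^ 'n" where
  "quad_grad Q c x = real_mat Q *v x + real_vec c"

definition affine_fn :: "real ^ 'n \<Rightarrow> real \<Rightarrow> real ^ 'n \<Rightarrow> real" where
  "affine_fn p \<alpha> x = p \<bullet> x + \<alpha>"

definition frac_obj ::
  "real ^ 'n \<Rightarrow> real \<Rightarrow> real ^ 'n \<Rightarrow> real \<Rightarrow> real ^ 'n \<Rightarrow> real" where
  "frac_obj p \<alpha> q \<beta> x = affine_fn p \<alpha> x / affine_fn q \<beta> x"

text \<open>Equality of functions is understood on the natural domain of the fraction.\<close>

definition pos_comb_of_linear_parts ::
  "nat \<Rightarrow> (nat \<Rightarrow> int ^ 'n) \<Rightarrow> real ^ 'n \<Rightarrow> real \<Rightarrow> real ^ 'n \<Rightarrow> real \<Rightarrow> bool" where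
  "pos_comb_of_linear_parts r c p \<alpha> q \<beta> \<longleftrightarrow>
     (\<exists>w :: nat \<Rightarrow> real. (\<forall>i\<in>{1..r}. 0 < w i) \<and>
        (\<forall>x. affine_fn q \<beta> x \<noteq> 0 \<longrightarrow>
           frac_obj p \<alpha> q \<beta> x = (\<Sum>i=1..r. w i * (real_vec (c i) \<bullet> x))))"

text \<open>On vectors, \<open>\<le>\<close> is the componentwise order.\<close>

definition polyhedron_le :: "int ^ 'n ^ 'm \<Rightarrow> int ^ 'm \<Rightarrow> (real ^ 'n) set" where
  "polyhedron_le A b = {x. 0 \<le> x \<and> real_mat A *v x \<le> real_vec b}"

text \<open>A row of a node's system is either a \<open>\<le>\<close>-constraint (with a slack variable)
  or a \<open>\<ge>\<close>-constraint (with a surplus variable).\<close>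

datatype row_sense = Le_row | Ge_row

fun sense_holds :: "row_sense \<Rightarrow> real \<Rightarrow> real \<Rightarrow> bool" where
  "sense_holds Le_row u v \<longleftrightarrow> u \<le> v"
| "sense_holds Ge_row u v \<longleftrightarrow> v \<le> u"

fun slack_coeff :: "row_sense \<Rightarrow> real" where
  "slack_coeff Le_row = 1"
| "slack_coeff Ge_row = - 1"

definition node_polyhedron ::
  "int ^ 'n ^ 'k \<Rightarrow> ('k \<Rightarrow> row_sense) \<Rightarrow> int ^ 'k \<Rightarrow> (real ^ 'n) set" where
  "node_polyhedron A \<sigma> b =
     {x. 0 \<le> x \<and> (\<forall>k. sense_holds (\<sigma> k) ((real_mat A *v x) $ k) (real_vec b $ k))}"

text \<open>The rows of the node system, indexed by \<open>'k\<close>, contain the rows of the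
  original system, indexed by \<open>'m\<close>, along an injection \<open>\<iota>\<close>; the
  remaining finitely many rows are the added ones.\<close>

definition extends_system ::
  "('m \<Rightarrow> 'k) \<Rightarrow> int ^ 'n ^ 'm \<Rightarrow> int ^ 'm \<Rightarrow>
   int ^ 'n ^ 'k \<Rightarrow> ('k \<Rightarrow> row_sense) \<Rightarrow> int ^ 'k \<Rightarrow> bool" where
  "extends_system \<iota> A b A' \<sigma> b' \<longleftrightarrow>
     inj \<iota> \<and> (\<forall>i. A' $ \<iota> i = A $ i \<and> b' $ \<iota> i = b $ i \<and> \<sigma> (\<iota> i) = Le_row)"

text \<open>The variables of the equality form are indexed by \<open>'n + 'k\<close>: \<open>Inl i\<close> is an
  original variable and \<open>Inr k\<close> is the slack or surplus variable of row \<open>k\<close>.\<close>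

definition eq_matrix ::
  "int ^ 'n ^ 'k \<Rightarrow> ('k \<Rightarrow> row_sense) \<Rightarrow> real ^ ('n::finite + 'k::finite) ^ 'k" where
  "eq_matrix A \<sigma> = (\<chi> k j. case j of
       Inl i \<Rightarrow> real_mat A $ k $ i
     | Inr k' \<Rightarrow> (if k' = k then slack_coeff (\<sigma> k) else 0))"

definition all_vars ::
  "int ^ 'n ^ 'k \<Rightarrow> ('k \<Rightarrow> row_sense) \<Rightarrow> int ^ 'k \<Rightarrow> real ^ 'n \<Rightarrow> real ^ ('n::finite + 'k::finite)" where
  "all_vars A \<sigma> b x = (\<chi> j. case j of
       Inl i \<Rightarrow> x $ i
     | Inr k \<Rightarrow> slack_coeff (\<sigma> k) * (real_vec b $ k - (real_mat A *v x) $ k))"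

definition orig_part :: "real ^ ('n::finite + 'k::finite) \<Rightarrow> real ^ 'n" where
  "orig_part y = (\<chi> i. y $ Inl i)"

definition ext_zero :: "real ^ 'n \<Rightarrow> real ^ ('n::finite + 'k::finite)" where
  "ext_zero p = (\<chi> j. case j of Inl i \<Rightarrow> p $ i | Inr _ \<Rightarrow> 0)"

lemma eq_matrix_all_vars_iff:
  "eq_matrix A \<sigma> *v y = real_vec b \<longleftrightarrow> y = all_vars A \<sigma> b (orig_part y)"
proof -
  have row: "(eq_matrix A \<sigma> *v y) $ k
      = (real_mat A *v orig_part y) $ k + slack_coeff (\<sigma> k) * y $ Inr k" for k
  proof -
    have "(eq_matrix A \<sigma> *v y) $ k
        = (\<Sum>j\<in>UNIV <+> UNIV. eq_matrix A \<sigma> $ k $ j * y $ j)"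
      by (simp add: matrix_vector_mult_def UNIV_Plus_UNIV)
    also have "\<dots> = (\<Sum>i\<in>UNIV. real_mat A $ k $ i * y $ Inl i)
        + (\<Sum>k'\<in>UNIV. (if k' = k then slack_coeff (\<sigma> k) else 0) * y $ Inr k')"
      by (subst sum.Plus) (simp_all add: eq_matrix_def)
    also have "(\<Sum>k'\<in>UNIV. (if k' = k then slack_coeff (\<sigma> k) else 0) * y $ Inr k')
        = slack_coeff (\<sigma> k) * y $ Inr k"
      by (simp add: if_distrib[of "\<lambda>u. u * _"] cong: if_cong)
    finally show ?thesis
      by (simp add: matrix_vector_mult_def orig_part_def)
  qed
  have sgn: "u + slack_coeff s * t = v \<longleftrightarrow> t = slack_coeff s * (v - u)" for u v t s
    by (cases s) auto
  show ?thesis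
    unfolding vec_eq_iff row sgn
    by (simp add: all_vars_def orig_part_def split_sum_all)
qed

lemma mem_node_polyhedron_iff:
  "x \<in> node_polyhedron A \<sigma> b \<longleftrightarrow> 0 \<le> all_vars A \<sigma> b x"
proof -
  have "sense_holds s u v \<longleftrightarrow> 0 \<le> slack_coeff s * (v - u)" for s u v
    by (cases s) auto
  then show ?thesis
    by (simp add: node_polyhedron_def all_vars_def less_eq_vec_def split_sum_all)
qed

text \<open>A basis is given by \<open>B :: 'k \<Rightarrow> 'v\<close>, where \<open>B t\<close> is the variable that is
  basic in tableau row \<open>t\<close>; so the set of basic indices is \<open>range B\<close> and the tableau row of
  a basic variable \<open>k\<close> is \<open>inv B k\<close>.\<close>

definition basis_matrix :: "real ^ 'v ^ 'k \<Rightarrow> ('k \<Rightarrow> 'v) \<Rightarrow> real ^ 'k ^ 'k" where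
  "basis_matrix M B = (\<chi> s t. M $ s $ B t)"

definition is_basis :: "real ^ 'v ^ 'k \<Rightarrow> ('k \<Rightarrow> 'v) \<Rightarrow> bool" where
  "is_basis M B \<longleftrightarrow> inj B \<and> invertible (basis_matrix M B)"

definition nonbasic :: "('k \<Rightarrow> 'v) \<Rightarrow> 'v set" where
  "nonbasic B = - range B"

definition tableau :: "real ^ 'v ^ 'k \<Rightarrow> ('k \<Rightarrow> 'v) \<Rightarrow> real ^ 'v ^ 'k" where
  "tableau M B = matrix_inv (basis_matrix M B) ** M"

definition tableau_rhs :: "real ^ 'v ^ 'k \<Rightarrow> real ^ 'k \<Rightarrow> ('k \<Rightarrow> 'v) \<Rightarrow> real ^ 'k" where
  "tableau_rhs M d B = matrix_inv (basis_matrix M B) *v d"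

definition basic_solution :: "real ^ 'v ^ 'k \<Rightarrow> real ^ 'k \<Rightarrow> ('k \<Rightarrow> 'v) \<Rightarrow> real ^ 'v" where
  "basic_solution M d B = (\<chi> j. if j \<in> range B then tableau_rhs M d B $ inv B j else 0)"

definition reduced_cost :: "real ^ 'v ^ 'k \<Rightarrow> ('k \<Rightarrow> 'v) \<Rightarrow> real ^ 'v \<Rightarrow> 'v \<Rightarrow> real" where
  "reduced_cost M B p j =
     p $ j - (\<chi> t. p $ B t) \<bullet> (matrix_inv (basis_matrix M B) *v column j M)"

definition frac_reduced_gradient ::
  "real ^ ('n::finite + 'k::finite) ^ 'k \<Rightarrow> ('k \<Rightarrow> 'n + 'k) \<Rightarrow> real ^ 'n \<Rightarrow> real \<Rightarrow> real ^ 'n \<Rightarrow> real \<Rightarrow>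
   real ^ 'n \<Rightarrow> 'n + 'k \<Rightarrow> real" where
  "frac_reduced_gradient M B p \<alpha> q \<beta> z j =
     affine_fn q \<beta> z * reduced_cost M B (ext_zero p) j
     - affine_fn p \<alpha> z * reduced_cost M B (ext_zero q) j"

definition quad_reduced_gradient ::
  "real ^ ('n::finite + 'k::finite) ^ 'k \<Rightarrow> ('k \<Rightarrow> 'n + 'k) \<Rightarrow> int ^ 'n ^ 'n \<Rightarrow> int ^ 'n \<Rightarrow>
   real ^ 'n \<Rightarrow> 'n + 'k \<Rightarrow> real" where
  "quad_reduced_gradient M B Q c z j =
     ext_zero (quad_grad Q c z) $ j
     - (\<Sum>i | Inl i \<in> range B. quad_grad Q c z $ i * tableau M B $ inv B (Inl i) $ j)"

text \<open>The solution \<open>z\<close> is expressed in the original variables. When the denominator is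
  positive on the polyhedron, minimality already follows from the sign condition on the
  reduced gradients; it is kept as part of the notion of an optimal basic solution.\<close>

definition optimal_tableau_solution ::
  "int ^ 'n ^ 'k \<Rightarrow> ('k \<Rightarrow> row_sense) \<Rightarrow> int ^ 'k \<Rightarrow>
   real ^ 'n \<Rightarrow> real \<Rightarrow> real ^ 'n \<Rightarrow> real \<Rightarrow> ('k \<Rightarrow> 'n + 'k) \<Rightarrow> real ^ 'n \<Rightarrow> bool" where
  "optimal_tableau_solution A \<sigma> b p \<alpha> q \<beta> B z \<longleftrightarrow>
     is_basis (eq_matrix A \<sigma>) B \<and>
     0 \<le> basic_solution (eq_matrix A \<sigma>) (real_vec b) B \<and>
     z = orig_part (basic_solution (eq_matrix A \<sigma>) (real_vec b) B) \<and>
     z \<in> node_polyhedron A \<sigma> b \<and>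
     (\<forall>y\<in>node_polyhedron A \<sigma> b. frac_obj p \<alpha> q \<beta> z \<le> frac_obj p \<alpha> q \<beta> y) \<and>
     (\<forall>j\<in>nonbasic B. 0 \<le> frac_reduced_gradient (eq_matrix A \<sigma>) B p \<alpha> q \<beta> z j)"

definition H_quad ::
  "real ^ ('n::finite + 'k::finite) ^ 'k \<Rightarrow> ('k \<Rightarrow> 'n + 'k) \<Rightarrow> nat \<Rightarrow> (nat \<Rightarrow> int ^ 'n ^ 'n) \<Rightarrow>
   (nat \<Rightarrow> int ^ 'n) \<Rightarrow> real ^ 'n \<Rightarrow> ('n::finite + 'k::finite) set" where
  "H_quad M B r Q c z =
     {j \<in> nonbasic B. \<exists>i\<in>{1..r}. quad_reduced_gradient M B (Q i) (c i) z j < 0} \<union>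
     {j \<in> nonbasic B. \<forall>i\<in>{1..r}. quad_reduced_gradient M B (Q i) (c i) z j = 0}"

definition H_frac ::
  "real ^ ('n::finite + 'k::finite) ^ 'k \<Rightarrow> ('k \<Rightarrow> 'n + 'k) \<Rightarrow> (nat \<Rightarrow> real ^ 'n) \<Rightarrow> (nat \<Rightarrow> real) \<Rightarrow>
   (nat \<Rightarrow> real ^ 'n) \<Rightarrow> (nat \<Rightarrow> real) \<Rightarrow> real ^ 'n \<Rightarrow> ('n::finite + 'k::finite) set" where
  "H_frac M B p \<alpha> q \<beta> z =
     {j \<in> nonbasic B. frac_reduced_gradient M B (p 2) (\<alpha> 2) (q 2) (\<beta> 2) z j < 0} \<union>
     {j \<in> nonbasic B. frac_reduced_gradient M B (p 1) (\<alpha> 1) (q 1) (\<beta> 1) z j = 0 \<and>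
                      frac_reduced_gradient M B (p 2) (\<alpha> 2) (q 2) (\<beta> 2) z j = 0}"

definition cut_domain ::
  "int ^ 'n ^ 'k \<Rightarrow> ('k \<Rightarrow> row_sense) \<Rightarrow> int ^ 'k \<Rightarrow> ('n::finite + 'k::finite) set \<Rightarrow> (real ^ 'n) set" where
  "cut_domain A \<sigma> b H = {x \<in> node_polyhedron A \<sigma> b. 1 \<le> (\<Sum>j\<in>H. all_vars A \<sigma> b x $ j)}"

end

theory Submission
  imports Defs
begin

text \<open>
  The integer efficient point \<open>x\<close> already lies in the second cut domain, because of how the
  reduced gradients describe the two fractions around the tableau solution \<open>z\<close> of the node.
  Eliminating the basic variables shows that for every point \<open>x\<close> of the node, with
  equality-form coordinates \<open>y\<close>, the cross-multiplied difference of \<open>\<psi>\<^sup>s\<close> at \<open>x\<close> and at \<open>z\<close>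
  is exactly the combination of the nonbasic \<open>y\<^sub>j\<close> whose coefficients are the reduced gradients of
  \<open>\<psi>\<^sup>s\<close> (\<open>sum_frac_reduced_gradient\<close>); there is no remainder term, since numerator
  and denominator are affine.

  Suppose that all \<open>y\<^sub>j\<close> with \<open>j\<close> in \<open>H'\<close> vanish. For a nonbasic \<open>j\<close> outside \<open>H'\<close> both
  reduced gradients are nonnegative (the first one by optimality of the tableau) and one of
  them is positive. As \<open>x \<noteq> z\<close>, some nonbasic \<open>y\<^sub>j\<close> is positive
  (\<open>eq_basic_solution_if_nonbasic_zero\<close>), and it lies outside \<open>H'\<close>. So the
  two combinations are nonnegative and one is positive: \<open>z\<close> is an integer feasible point that
  dominates \<open>x\<close>, contrary to the efficiency of \<open>x\<close>. Hence some \<open>y\<^sub>j\<close> with \<open>j\<close> in \<open>H'\<close> is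
  nonzero. All data of the system being integral, \<open>y\<close> is an integral nonnegative vector, and so
  \<open>y\<^sub>j\<close> is at least \<open>1\<close>, which is the cut (\<open>mem_cut_domainI\<close>).
\<close>

section \<open>Reduced costs\<close>

lemma inner_basic_solution:
  assumes "inj B"
  shows "p \<bullet> basic_solution M d B = (\<chi> t. p $ B t) \<bullet> tableau_rhs M d B"
proof -
  have "p \<bullet> basic_solution M d B
      = (\<Sum>j\<in>range B. p $ j * tableau_rhs M d B $ inv B j)"
    by (simp add: inner_vec_def basic_solution_def if_distrib sum.If_cases cong: if_cong)
  also have "\<dots> = (\<Sum>t\<in>UNIV. p $ B t * tableau_rhs M d B $ t)"
    using assms by (simp add: sum.reindex)
  finally show ?thesis by (simp add: inner_vec_def)
qed

lemma reduced_cost_basic: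
  fixes M :: "real ^ 'v::finite ^ 'k::finite"
  assumes "is_basis M B"
  shows "reduced_cost M B p (B t) = 0"
proof -
  let ?C = "basis_matrix M B"
  have "column (B t) M = ?C *v axis t 1"
    by (simp add: matrix_vector_mul_component vec_eq_iff column_def basis_matrix_def
        inner_axis)
  moreover have "matrix_inv ?C ** ?C = mat 1"
    using assms unfolding is_basis_def invertible_def matrix_inv_def
    by (metis (mono_tags, lifting) someI_ex)
  ultimately have "matrix_inv ?C *v column (B t) M = axis t 1"
    by (simp add: matrix_vector_mul_assoc)
  then show ?thesis
    by (simp add: reduced_cost_def inner_axis)
qed

text \<open>Along the solutions of the equality system a linear function depends on the nonbasic
  coordinates only, and the reduced costs are its coefficients there. The elimination of the
  basic variables amounts to applying the inverse basis matrix to the whole system and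
  using that the reduced costs of basic variables vanish.\<close>

lemma sum_reduced_cost:
  fixes M :: "real ^ 'v::finite ^ 'k::finite"
  assumes "is_basis M B" and "M *v y = d"
  shows "(\<Sum>j\<in>nonbasic B. reduced_cost M B p j * y $ j) = p \<bullet> y - p \<bullet> basic_solution M d B"
proof -
  let ?I = "matrix_inv (basis_matrix M B)" and ?pB = "\<chi> t. p $ B t"
  have "(\<Sum>j\<in>nonbasic B. reduced_cost M B p j * y $ j)
      = (\<Sum>j\<in>UNIV. reduced_cost M B p j * y $ j)"
    using reduced_cost_basic[OF assms(1)]
    by (intro sum.mono_neutral_left) (auto simp: nonbasic_def)
  also have "\<dots> = p \<bullet> y - (\<Sum>j\<in>UNIV. ?pB \<bullet> (?I *v column j M) * y $ j)"
    by (simp add: reduced_cost_def left_diff_distrib sum_subtractf inner_vec_def)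
  also have "(\<Sum>j\<in>UNIV. ?pB \<bullet> (?I *v column j M) * y $ j)
      = ?pB \<bullet> (?I *v (\<Sum>j\<in>UNIV. y $ j *\<^sub>R column j M))"
    by (simp add: linear_sum[OF matrix_vector_mul_linear] inner_sum_right
        linear_cmul[OF matrix_vector_mul_linear] mult.commute)
  also have "(\<Sum>j\<in>UNIV. y $ j *\<^sub>R column j M) = d"
    using assms(2) by (simp add: matrix_mult_sum scalar_mult_eq_scaleR)
  finally show ?thesis
    using assms(1) by (simp add: inner_basic_solution is_basis_def tableau_rhs_def)
qed

text \<open>Each coordinate is itself a linear function, so its change from the basic solution is a
  combination of the nonbasic coordinates.\<close>

lemma eq_basic_solution_if_nonbasic_zero:
  fixes M :: "real ^ 'v::finite ^ 'k::finite"
  assumes "is_basis M B" and "M *v y = d" and "\<And>j. j \<in> nonbasic B \<Longrightarrow> y $ j = 0"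
  shows "y = basic_solution M d B"
proof (rule vec_eq_iff[THEN iffD2], rule allI)
  fix i
  have "axis i 1 \<bullet> y - axis i 1 \<bullet> basic_solution M d B = 0"
    using sum_reduced_cost[OF assms(1,2), of "axis i 1"] assms(3) by simp
  then show "y $ i = basic_solution M d B $ i"
    by (simp add: inner_axis')
qed

section \<open>Node coordinates\<close>

lemma orig_part_all_vars [simp]: "orig_part (all_vars A \<sigma> b x) = x"
  by (simp add: orig_part_def all_vars_def)

lemma eq_matrix_mult_all_vars: "eq_matrix A \<sigma> *v all_vars A \<sigma> b x = real_vec b"
  by (simp add: eq_matrix_all_vars_iff)

lemma inner_ext_zero: "ext_zero p \<bullet> y = p \<bullet> orig_part y"
proof -
  have "ext_zero p \<bullet> y = (\<Sum>j\<in>UNIV <+> UNIV. ext_zero p $ j * y $ j)"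
    by (simp add: inner_vec_def UNIV_Plus_UNIV)
  also have "\<dots> = p \<bullet> orig_part y"
    by (subst sum.Plus) (simp_all add: ext_zero_def inner_vec_def orig_part_def)
  finally show ?thesis .
qed

lemma all_vars_in_Ints:
  assumes "x \<in> integer_points"
  shows "all_vars A \<sigma> b x $ j \<in> \<int>"
proof (cases j)
  case (Inl i)
  then show ?thesis using assms by (simp add: all_vars_def integer_points_def)
next
  case (Inr k)
  have "(real_mat A *v x) $ k \<in> \<int>"
    using assms
    by (auto simp: matrix_vector_mult_def real_mat_def map_matrix_def integer_points_def
        intro!: Ints_sum Ints_mult)
  moreover have "slack_coeff (\<sigma> k) \<in> \<int>" by (cases "\<sigma> k") auto
  ultimately show ?thesis
    using Inr by (simp add: all_vars_def real_vec_def)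
qed

text \<open>A nonnegative integer is either zero or at least one: a cut excludes only those integer
  points all of whose coordinates in the index set vanish.\<close>

lemma mem_cut_domainI:
  assumes "x \<in> node_polyhedron A \<sigma> b" and "x \<in> integer_points"
    and "j \<in> H" and "all_vars A \<sigma> b x $ j \<noteq> 0"
  shows "x \<in> cut_domain A \<sigma> b H"
proof -
  let ?y = "all_vars A \<sigma> b x"
  have nonneg: "0 \<le> ?y $ i" for i
    using assms(1) by (simp add: mem_node_polyhedron_iff less_eq_vec_def)
  have "1 \<le> \<bar>?y $ j\<bar>"
    using Ints_nonzero_abs_ge1[OF all_vars_in_Ints[OF assms(2)] assms(4)] .
  then have "1 \<le> ?y $ j"
    using nonneg[of j] by simp
  also have "\<dots> \<le> (\<Sum>i\<in>H. ?y $ i)"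
    using assms(3) nonneg by (intro member_le_sum) auto
  finally show ?thesis
    using assms(1) by (simp add: cut_domain_def)
qed

lemma node_polyhedron_subset_polyhedron_le:
  assumes "extends_system \<iota> A b A' \<sigma> b'"
  shows "node_polyhedron A' \<sigma> b' \<subseteq> polyhedron_le A b"
proof
  fix x assume x: "x \<in> node_polyhedron A' \<sigma> b'"
  have "(real_mat A *v x) $ i \<le> real_vec b $ i" for i
  proof -
    have "sense_holds (\<sigma> (\<iota> i)) ((real_mat A' *v x) $ \<iota> i) (real_vec b' $ \<iota> i)"
      using x by (simp add: node_polyhedron_def)
    then show ?thesis
      using assms
      by (simp add: extends_system_def matrix_vector_mult_def real_mat_def map_matrix_def
          real_vec_def)
  qed
  then show "x \<in> polyhedron_le A b"
    using x by (simp add: polyhedron_le_def node_polyhedron_def less_eq_vec_def)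
qed

section \<open>Reduced gradients of the fractional objectives\<close>

text \<open>The reduced gradient is the combination of the reduced costs of numerator and denominator
  whose constant weights \<open>\<Q>(z)\<close> and \<open>\<P>(z)\<close> make the terms \<open>\<P>(z) \<Q>(z)\<close> cancel.\<close>

lemma sum_frac_reduced_gradient:
  assumes "is_basis (eq_matrix A \<sigma>) B"
    and "z = orig_part (basic_solution (eq_matrix A \<sigma>) (real_vec b) B)"
  shows "(\<Sum>j\<in>nonbasic B.
        frac_reduced_gradient (eq_matrix A \<sigma>) B p \<alpha> q \<beta> z j * all_vars A \<sigma> b x $ j)
      = affine_fn q \<beta> z * affine_fn p \<alpha> x - affine_fn p \<alpha> z * affine_fn q \<beta> x"
proof -
  let ?M = "eq_matrix A \<sigma>" and ?y = "all_vars A \<sigma> b x"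
  have rc: "(\<Sum>j\<in>nonbasic B. reduced_cost ?M B (ext_zero w) j * ?y $ j) = w \<bullet> x - w \<bullet> z" for w
    using sum_reduced_cost[OF assms(1) eq_matrix_mult_all_vars, of "ext_zero w" b x]
    by (simp add: inner_ext_zero assms(2))
  have "(\<Sum>j\<in>nonbasic B. frac_reduced_gradient ?M B p \<alpha> q \<beta> z j * ?y $ j)
      = affine_fn q \<beta> z * (p \<bullet> x - p \<bullet> z) - affine_fn p \<alpha> z * (q \<bullet> x - q \<bullet> z)"
    by (simp add: frac_reduced_gradient_def left_diff_distrib sum_subtractf mult.assoc
        sum_distrib_left[symmetric] rc)
  then show ?thesis
    by (simp add: affine_fn_def algebra_simps)
qed

lemma frac_obj_le_iff:
  assumes "0 < affine_fn q \<beta> x" and "0 < affine_fn q \<beta> z"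
  shows "frac_obj p \<alpha> q \<beta> z \<le> frac_obj p \<alpha> q \<beta> x \<longleftrightarrow>
    0 \<le> affine_fn q \<beta> z * affine_fn p \<alpha> x - affine_fn p \<alpha> z * affine_fn q \<beta> x"
    and "frac_obj p \<alpha> q \<beta> z < frac_obj p \<alpha> q \<beta> x \<longleftrightarrow>
    0 < affine_fn q \<beta> z * affine_fn p \<alpha> x - affine_fn p \<alpha> z * affine_fn q \<beta> x"
  using assms by (simp_all add: frac_obj_def field_simps)

text \<open>The set \<open>H_frac\<close> holds every nonbasic direction along which the second fraction improves or
  both stay the same, and by optimality no direction improves the first. Each direction outside it
  therefore worsens a fraction and improves none, and this persists for the sum of
  such directions that leads from \<open>z\<close> to \<open>x\<close>.\<close>

lemma dominated_if_zero_on_H_frac: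
  fixes A :: "int ^ 'n::finite ^ 'k::finite"
  assumes opt: "optimal_tableau_solution A \<sigma> b (p 1) (\<alpha> 1) (q 1) (\<beta> 1) B z"
    and x: "x \<in> node_polyhedron A \<sigma> b" "x \<noteq> z"
    and zero: "\<And>j. j \<in> H_frac (eq_matrix A \<sigma>) B p \<alpha> q \<beta> z \<Longrightarrow> all_vars A \<sigma> b x $ j = 0"
    and pos: "\<And>s. s \<in> {1, 2} \<Longrightarrow> 0 < affine_fn (q s) (\<beta> s) x"
      "\<And>s. s \<in> {1, 2} \<Longrightarrow> 0 < affine_fn (q s) (\<beta> s) z"
  shows "(\<forall>s\<in>{1, 2}. frac_obj (p s) (\<alpha> s) (q s) (\<beta> s) z \<le> frac_obj (p s) (\<alpha> s) (q s) (\<beta> s) x) \<and>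
    (\<exists>s\<in>{1, 2}. frac_obj (p s) (\<alpha> s) (q s) (\<beta> s) z < frac_obj (p s) (\<alpha> s) (q s) (\<beta> s) x)"
proof -
  let ?M = "eq_matrix A \<sigma>" and ?y = "all_vars A \<sigma> b x"
  define g where "g s j = frac_reduced_gradient ?M B (p s) (\<alpha> s) (q s) (\<beta> s) z j" for s j
  have basis: "is_basis ?M B" and z: "z = orig_part (basic_solution ?M (real_vec b) B)"
    using opt by (auto simp: optimal_tableau_solution_def)
  have g1: "0 \<le> g 1 j" if "j \<in> nonbasic B" for j
    using opt that unfolding optimal_tableau_solution_def g_def by blast
  have y_nonneg: "0 \<le> ?y $ j" for j
    using x(1) by (simp add: mem_node_polyhedron_iff less_eq_vec_def)
  have outside: "0 \<le> g 2 j \<and> (0 < g 1 j \<or> 0 < g 2 j)"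
    if "j \<in> nonbasic B" "?y $ j \<noteq> 0" for j
    using zero[of j] g1[of j] that by (fastforce simp: H_frac_def g_def)
  have term_nonneg: "0 \<le> g s j * ?y $ j" if "s \<in> {1, 2}" "j \<in> nonbasic B" for s j
    using that g1[of j] outside[of j] y_nonneg[of j] by (cases "?y $ j = 0") auto
  have "\<not> (\<forall>j\<in>nonbasic B. ?y $ j = 0)"
    using eq_basic_solution_if_nonbasic_zero[OF basis eq_matrix_mult_all_vars] x(2) z
    by (metis orig_part_all_vars)
  then obtain j where j: "j \<in> nonbasic B" "?y $ j \<noteq> 0" by blast
  obtain s where s: "s \<in> {1, 2}" "0 < g s j"
    using outside[OF j] by blast
  have "0 < g s j * ?y $ j"
    using s(2) j(2) y_nonneg[of j] by simp
  then have "0 < (\<Sum>j\<in>nonbasic B. g s j * ?y $ j)"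
    using j(1) term_nonneg[OF s(1)] by (intro sum_pos2[where i = j]) auto
  moreover have "0 \<le> (\<Sum>j\<in>nonbasic B. g s j * ?y $ j)" if "s \<in> {1, 2}" for s
    using term_nonneg[OF that] by (intro sum_nonneg) auto
  ultimately show ?thesis
    using s(1) pos
    unfolding g_def sum_frac_reduced_gradient[OF basis z] by (metis frac_obj_le_iff)
qed

section \<open>Validity of the cut\<close>

theorem theorem3:
  fixes r :: nat
    and A :: "int ^ 'n ^ 'm" and b :: "int ^ 'm"
    and Q :: "nat \<Rightarrow> int ^ 'n ^ 'n" and c :: "nat \<Rightarrow> int ^ 'n"
    and p q :: "nat \<Rightarrow> real ^ 'n" and \<alpha> \<beta> :: "nat \<Rightarrow> real"
    and \<iota> :: "'m::finite \<Rightarrow> 'k::finite"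
    and A\<^sub>l :: "int ^ 'n ^ 'k" and \<sigma>\<^sub>l :: "'k::finite \<Rightarrow> row_sense" and b\<^sub>l :: "int ^ 'k"
    and B\<^sub>l :: "'k::finite \<Rightarrow> 'n::finite + 'k" and x_opt x :: "real ^ 'n"
    and X D X_Q X_F X_Eff X\<^sub>l X1 X2 :: "(real ^ 'n) set" and H H' :: "('n::finite + 'k::finite) set"
  defines "X \<equiv> polyhedron_le A b"
    and "D \<equiv> X \<inter> integer_points"
    and "X_Q \<equiv> efficient_set {1..r} (\<lambda>i. quad_obj (Q i) (c i)) D"
    and "X_F \<equiv> efficient_set {1, 2} (\<lambda>s. frac_obj (p s) (\<alpha> s) (q s) (\<beta> s)) D"
    and "X_Eff \<equiv> X_Q \<inter> X_F"
    and "X\<^sub>l \<equiv> node_polyhedron A\<^sub>l \<sigma>\<^sub>l b\<^sub>l"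
    and "H \<equiv> H_quad (eq_matrix A\<^sub>l \<sigma>\<^sub>l) B\<^sub>l r Q c x_opt"
    and "H' \<equiv> H_frac (eq_matrix A\<^sub>l \<sigma>\<^sub>l) B\<^sub>l p \<alpha> q \<beta> x_opt"
    and "X1 \<equiv> cut_domain A\<^sub>l \<sigma>\<^sub>l b\<^sub>l H"
    and "X2 \<equiv> cut_domain A\<^sub>l \<sigma>\<^sub>l b\<^sub>l H'"
  assumes "r \<ge> 2"
    and "bounded X" and "X \<noteq> {}"
    and "\<forall>i\<in>{1..r}. symmetric_pos_semidef (real_mat (Q i))"
    and "\<forall>s\<in>{1, 2}. \<forall>y\<in>X. affine_fn (q s) (\<beta> s) y > 0"
    and "\<forall>s\<in>{1, 2}. \<not> pos_comb_of_linear_parts r c (p s) (\<alpha> s) (q s) (\<beta> s)"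
    and "X_Q \<noteq> D"
    and "extends_system \<iota> A b A\<^sub>l \<sigma>\<^sub>l b\<^sub>l"
    and "optimal_tableau_solution A\<^sub>l \<sigma>\<^sub>l b\<^sub>l (p 1) (\<alpha> 1) (q 1) (\<beta> 1) B\<^sub>l x_opt"
    and "x_opt \<in> integer_points"
    and "H \<noteq> {}" and "H' \<noteq> {}"
    and "x \<in> X_Eff \<inter> (X\<^sub>l - {x_opt})"
  shows "x \<in> X1 \<union> X2"
proof -
  have x: "x \<in> D" "x \<in> X_F" "x \<in> X\<^sub>l" "x \<noteq> x_opt" "x \<in> integer_points"
    using \<open>x \<in> X_Eff \<inter> (X\<^sub>l - {x_opt})\<close>
    by (auto simp: X_Eff_def X_F_def D_def efficient_set_def)
  have "x_opt \<in> X"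
    using node_polyhedron_subset_polyhedron_le[OF \<open>extends_system \<iota> A b A\<^sub>l \<sigma>\<^sub>l b\<^sub>l\<close>]
      \<open>optimal_tableau_solution A\<^sub>l \<sigma>\<^sub>l b\<^sub>l (p 1) (\<alpha> 1) (q 1) (\<beta> 1) B\<^sub>l x_opt\<close>
    by (auto simp: optimal_tableau_solution_def X_def)
  then have z: "x_opt \<in> D"
    using \<open>x_opt \<in> integer_points\<close> by (simp add: D_def)
  have pos: "0 < affine_fn (q s) (\<beta> s) y" if "s \<in> {1, 2}" "y \<in> D" for s y
    using \<open>\<forall>s\<in>{1, 2}. \<forall>y\<in>X. affine_fn (q s) (\<beta> s) y > 0\<close> that by (auto simp: D_def)
  have "\<exists>j\<in>H'. all_vars A\<^sub>l \<sigma>\<^sub>l b\<^sub>l x $ j \<noteq> 0"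
  proof (rule ccontr)
    assume "\<not> ?thesis"
    then have "all_vars A\<^sub>l \<sigma>\<^sub>l b\<^sub>l x $ j = 0"
      if "j \<in> H_frac (eq_matrix A\<^sub>l \<sigma>\<^sub>l) B\<^sub>l p \<alpha> q \<beta> x_opt" for j
      using that by (simp add: H'_def)
    from dominated_if_zero_on_H_frac
        [where p = p and q = q and \<alpha> = \<alpha> and \<beta> = \<beta>,
         OF \<open>optimal_tableau_solution A\<^sub>l \<sigma>\<^sub>l b\<^sub>l (p 1) (\<alpha> 1) (q 1) (\<beta> 1) B\<^sub>l x_opt\<close>
          x(3)[unfolded X\<^sub>l_def] x(4) this pos[OF _ x(1)] pos[OF _ z]]
    show False
      using x(2) z by (auto simp: X_F_def efficient_set_def)
  qed
  then have "x \<in> X2"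
    using x(3,5) mem_cut_domainI by (auto simp: X2_def X\<^sub>l_def)
  then show ?thesis by simp
qed

end
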